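(* Let $\lambda\in\mathbb R$ and suppose that $u_1,u_2$ are two linearly independent real-valued solutions of $(\tau-\lambda)u=0$. If $x_1,x_2\in(a,b)$, $x_1<x_2$, are two zeros of $u_1$ and $p$ is sign-definite on $(x_1,x_2)$ (i.e. $p>0$ a.e. or $p<0$ a.e. on $(x_1,x_2)$), then $u_2$ has at least one zero in $[x_1,x_2]$. If, in addition, $\tau$ is regular at the endpoint $a$ and $x_1=a$ (i.e. $u_1(a)=u_1(x_2)=0$ with $x_2\in(a,b)$ and $p$ sign-definite on $(a,x_2)$), then $u_2$ has a zero in $[a,x_2]$. An analogous result holds if $\tau$ is regular at the endpoint $b$.
   Context: Setting. $(a,b)\subseteq\mathbb R$ is an open interval (possibly unbounded); $p,q,r,s$ are Lebesgue measurable and real-valued a.e. on $(a,b)$, with $p^{-1},q,r,s\in L^1_{\mathrm{loc}}((a,b);dx)$, $r>0$ and $p\neq0$ a.e. For $f\in AC_{\mathrm{loc}}((a,b))$ put $f^{[1]}=p(f'+sf)$, $\mathfrak D_\tau=\{f\in AC_{\mathrm{loc}}((a,b)) : f^{[1]}\in AC_{\mathrm{loc}}((a,b))\}$, and $\tau f=\frac1r\big(-(f^{[1]})'+sf^{[1]}+qf\big)$ for $f\in\mathfrak D_\tau$; solutions of $(\tau-\lambda)u=0$ are elements of $\mathfrak D_\tau$. $\tau$ is regular at $a$ (resp. $b$) if $p^{-1},q,r,s$ are integrable near $a$ (resp. $b$); in that case every solution $u$ of $(\tau-\lambda)u=0$ has a finite limit $u(a)=\lim_{x\downarrow a}u(x)$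 (resp. $u(b)=\lim_{x\uparrow b}u(x)$), and a zero at that endpoint means that this limit vanishes. *)

theory Defs
  imports "HOL-Analysis.Analysis"
begin

text \<open>
  The open interval \<open>(a,b)\<close>, possibly unbounded, is \<^const>\<open>einterval\<close> \<open>a b\<close> with extended real end
  points. All functions are total functions on the reals; only their values on the interval matter.
\<close>

definition locally_integrable :: "real set \<Rightarrow> (real \<Rightarrow> real) \<Rightarrow> bool" where
  "locally_integrable I f \<longleftrightarrow> (\<forall>K. compact K \<and> K \<subseteq> I \<longrightarrow> set_integrable lebesgue K f)"

definition AC_on :: "real \<Rightarrow> real \<Rightarrow> (real \<Rightarrow> real) \<Rightarrow> bool" where
  "AC_on c d f \<longleftrightarrow>
     (\<forall>\<epsilon>>0. \<exists>\<delta>>0. \<forall>(n::nat) x y.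
        (\<forall>i<n. c \<le> x i \<and> x i \<le> y i \<and> y i \<le> d) \<and>
        disjoint_family_on (\<lambda>i. {x i<..<y i}) {..<n} \<and>
        (\<Sum>i<n. y i - x i) < \<delta>
        \<longrightarrow> (\<Sum>i<n. \<bar>f (y i) - f (x i)\<bar>) < \<epsilon>)"

definition AC_loc :: "real set \<Rightarrow> (real \<Rightarrow> real) \<Rightarrow> bool" where
  "AC_loc I f \<longleftrightarrow> (\<forall>c d. {c..d} \<subseteq> I \<longrightarrow> AC_on c d f)"

text \<open>
  The derivative of a locally absolutely continuous function exists almost everywhere and is
  determined up to null sets; \<open>f'\<close> below is any representative of it.
\<close>

definition has_ae_derivative :: "real set \<Rightarrow> (real \<Rightarrow> real) \<Rightarrow> (real \<Rightarrow> real) \<Rightarrow> bool" where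
  "has_ae_derivative I f f' \<longleftrightarrow> (AE x\<in>I in lebesgue. (f has_real_derivative f' x) (at x))"

text \<open>
  \<open>g\<close> represents \<open>f\<^sup>[\<^sup>1\<^sup>] = p (f' + s f)\<close>, an almost everywhere defined function. That it lies
  in \<^const>\<open>AC_loc\<close> means that it has a representative there, which is unique on \<open>I\<close>.
\<close>

definition quasi_derivative ::
  "real set \<Rightarrow> (real \<Rightarrow> real) \<Rightarrow> (real \<Rightarrow> real) \<Rightarrow> (real \<Rightarrow> real) \<Rightarrow> (real \<Rightarrow> real) \<Rightarrow> bool" where
  "quasi_derivative I p s f g \<longleftrightarrow>
     (\<exists>f'. has_ae_derivative I f f' \<and> (AE x\<in>I in lebesgue. g x = p x * (f' x + s x * f x)))"

definition tau_domain :: "real set \<Rightarrow> (real \<Rightarrow> real) \<Rightarrow> (real \<Rightarrow> real) \<Rightarrow> (real \<Rightarrow> real) set" where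
  "tau_domain I p s = {f. AC_loc I f \<and> (\<exists>g. AC_loc I g \<and> quasi_derivative I p s f g)}"

text \<open>
  \<open>\<tau>f\<close> is likewise only determined almost everywhere, so \<open>\<tau>\<close> is given by its graph:
  \<open>tau_graph I p q r s f h\<close> means \<open>\<tau>f = h\<close> almost everywhere on \<open>I\<close>.
\<close>

definition tau_graph ::
  "real set \<Rightarrow> (real \<Rightarrow> real) \<Rightarrow> (real \<Rightarrow> real) \<Rightarrow> (real \<Rightarrow> real) \<Rightarrow> (real \<Rightarrow> real) \<Rightarrow>
   (real \<Rightarrow> real) \<Rightarrow> (real \<Rightarrow> real) \<Rightarrow> bool" where
  "tau_graph I p q r s f h \<longleftrightarrow> f \<in> tau_domain I p s \<and>
     (\<exists>g g'. AC_loc I g \<and> quasi_derivative I p s f g \<and> has_ae_derivative I g g' \<and>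
        (AE x\<in>I in lebesgue. h x = 1 / r x * (- g' x + s x * g x + q x * f x)))"

definition solution ::
  "real set \<Rightarrow> (real \<Rightarrow> real) \<Rightarrow> (real \<Rightarrow> real) \<Rightarrow> (real \<Rightarrow> real) \<Rightarrow> (real \<Rightarrow> real) \<Rightarrow>
   real \<Rightarrow> (real \<Rightarrow> real) \<Rightarrow> bool" where
  "solution I p q r s lam u \<longleftrightarrow> tau_graph I p q r s u (\<lambda>x. lam * u x)"

definition lin_indep_pair_on :: "real set \<Rightarrow> (real \<Rightarrow> real) \<Rightarrow> (real \<Rightarrow> real) \<Rightarrow> bool" where
  "lin_indep_pair_on I u v \<longleftrightarrow>
     (\<forall>c d. (\<forall>x\<in>I. c * u x + d * v x = 0) \<longrightarrow> c = 0 \<and> d = 0)"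

definition sign_definite_on :: "real set \<Rightarrow> (real \<Rightarrow> real) \<Rightarrow> bool" where
  "sign_definite_on J p \<longleftrightarrow>
     (AE x\<in>J in lebesgue. p x > 0) \<or> (AE x\<in>J in lebesgue. p x < 0)"

definition integrable_near_left :: "ereal \<Rightarrow> ereal \<Rightarrow> (real \<Rightarrow> real) \<Rightarrow> bool" where
  "integrable_near_left a b f \<longleftrightarrow>
     (\<exists>c\<in>einterval a b. set_integrable lebesgue (einterval a (ereal c)) f)"

definition integrable_near_right :: "ereal \<Rightarrow> ereal \<Rightarrow> (real \<Rightarrow> real) \<Rightarrow> bool" where
  "integrable_near_right a b f \<longleftrightarrow>
     (\<exists>c\<in>einterval a b. set_integrable lebesgue (einterval (ereal c) b) f)"

text \<open>An infinite end point may be regular; only integrability of the coefficients is required.\<close>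

definition regular_left ::
  "ereal \<Rightarrow> ereal \<Rightarrow> (real \<Rightarrow> real) \<Rightarrow> (real \<Rightarrow> real) \<Rightarrow> (real \<Rightarrow> real) \<Rightarrow> (real \<Rightarrow> real) \<Rightarrow> bool" where
  "regular_left a b p q r s \<longleftrightarrow>
     integrable_near_left a b (\<lambda>x. 1 / p x) \<and> integrable_near_left a b q \<and>
     integrable_near_left a b r \<and> integrable_near_left a b s"

definition regular_right ::
  "ereal \<Rightarrow> ereal \<Rightarrow> (real \<Rightarrow> real) \<Rightarrow> (real \<Rightarrow> real) \<Rightarrow> (real \<Rightarrow> real) \<Rightarrow> (real \<Rightarrow> real) \<Rightarrow> bool" where
  "regular_right a b p q r s \<longleftrightarrow>
     integrable_near_right a b (\<lambda>x. 1 / p x) \<and> integrable_near_right a b q \<and>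
     integrable_near_right a b r \<and> integrable_near_right a b s"

text \<open>
  A zero at an end point: the one-sided limit of \<open>u\<close> there, taken in the extended reals so that
  infinite end points are covered, vanishes.
\<close>

definition zero_at_left_end :: "ereal \<Rightarrow> (real \<Rightarrow> real) \<Rightarrow> bool" where
  "zero_at_left_end a u \<longleftrightarrow> ((u \<circ> real_of_ereal) \<longlongrightarrow> 0) (at_right a)"

definition zero_at_right_end :: "ereal \<Rightarrow> (real \<Rightarrow> real) \<Rightarrow> bool" where
  "zero_at_right_end b u \<longleftrightarrow> ((u \<circ> real_of_ereal) \<longlongrightarrow> 0) (at_left b)"

end

theory Submission
  imports Defs
begin

text \<open>
  Suppose \<open>u\<^sub>2\<close> has no zero on the interval. The Wronskian \<open>W = u\<^sub>1 u\<^sub>2\<^sup>[\<^sup>1\<^sup>] - u\<^sub>1\<^sup>[\<^sup>1\<^sup>] u\<^sub>2\<close> is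
  constant, and it is not zero: otherwise \<open>u\<^sub>1\<close> and its quasi-derivative would vanish at a common
  point and \<open>u\<^sub>1\<close> would vanish identically. Since \<open>(u\<^sub>1 / u\<^sub>2)' = - W / (p u\<^sub>2\<^sup>2)\<close> has a sign almost
  everywhere, \<open>u\<^sub>1 / u\<^sub>2\<close> is strictly monotone, so it cannot vanish at two points. At an end point
  of \<open>(a, b)\<close>, strict monotonicity and the interior zero of \<open>u\<^sub>1\<close> keep \<open>\<bar>u\<^sub>1 / u\<^sub>2\<bar>\<close> away from \<open>0\<close>, so
  that \<open>u\<^sub>1 \<rightarrow> 0\<close> forces \<open>u\<^sub>2 \<rightarrow> 0\<close>.
\<close>

section \<open>Absolutely continuous functions\<close>

text \<open>Bridge between the almost-everywhere statements in the definitions and the negligible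
  sets of the gauge integral, in which derivatives are integrated below.\<close>

lemma AE_lebesgue_on_iff_negligible:
  fixes S :: "'a::euclidean_space set"
  shows "(AE x\<in>S in lebesgue. P x) \<longleftrightarrow> negligible {x \<in> S. \<not> P x}"
proof
  assume "AE x\<in>S in lebesgue. P x"
  then obtain N where "{x \<in> space lebesgue. \<not> (x \<in> S \<longrightarrow> P x)} \<subseteq> N" "N \<in> null_sets lebesgue"
    unfolding eventually_ae_filter by blast
  then show "negligible {x \<in> S. \<not> P x}"
    by (auto simp: negligible_iff_null_sets[symmetric] intro: negligible_subset)
next
  assume "negligible {x \<in> S. \<not> P x}"
  then show "AE x\<in>S in lebesgue. P x"
    unfolding negligible_iff_null_sets by (rule AE_I') auto
qed

lemma AC_on_mono:
  assumes "AC_on c d f" "c \<le> c'" "d' \<le> d"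
  shows "AC_on c' d' f"
  unfolding AC_on_def
proof (intro allI impI)
  fix e :: real assume "e > 0"
  then obtain \<delta> where \<delta>: "\<delta> > 0" and
    *: "\<And>(n::nat) x y. (\<forall>i<n. c \<le> x i \<and> x i \<le> y i \<and> y i \<le> d) \<Longrightarrow>
        disjoint_family_on (\<lambda>i. {x i<..<y i}) {..<n} \<Longrightarrow>
        (\<Sum>i<n. y i - x i) < \<delta> \<Longrightarrow> (\<Sum>i<n. \<bar>f (y i) - f (x i)\<bar>) < e"
    using assms(1) unfolding AC_on_def by meson
  show "\<exists>\<delta>>0. \<forall>(n::nat) x y.
        (\<forall>i<n. c' \<le> x i \<and> x i \<le> y i \<and> y i \<le> d') \<and>
        disjoint_family_on (\<lambda>i. {x i<..<y i}) {..<n} \<and>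
        (\<Sum>i<n. y i - x i) < \<delta> \<longrightarrow> (\<Sum>i<n. \<bar>f (y i) - f (x i)\<bar>) < e"
    by (rule exI[of _ \<delta>]) (intro conjI \<delta> allI impI *; use assms in force)
qed

text \<open>\<open>AC_on\<close> speaks of families indexed by initial segments of the naturals.
  Arbitrary finite index sets are reached through an enumeration, so that a set of tagged intervals
  can index itself.\<close>

lemma AC_on_finite_set:
  assumes "AC_on c d f" "e > 0"
  shows "\<exists>\<delta>>0. \<forall>J x y. finite J \<and> (\<forall>j\<in>J. c \<le> x j \<and> x j \<le> y j \<and> y j \<le> d) \<and>
        disjoint_family_on (\<lambda>j. {x j<..<y j}) J \<and>
        (\<Sum>j\<in>J. y j - x j) < \<delta> \<longrightarrow> (\<Sum>j\<in>J. \<bar>f (y j) - f (x j)\<bar>) < e"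
proof -
  obtain \<delta> where \<delta>: "\<delta> > 0" and
    *: "\<And>(n::nat) x y. (\<forall>i<n. c \<le> x i \<and> x i \<le> y i \<and> y i \<le> d) \<Longrightarrow>
        disjoint_family_on (\<lambda>i. {x i<..<y i}) {..<n} \<Longrightarrow>
        (\<Sum>i<n. y i - x i) < \<delta> \<Longrightarrow> (\<Sum>i<n. \<bar>f (y i) - f (x i)\<bar>) < e"
    using assms unfolding AC_on_def by meson
  show ?thesis
  proof (intro exI[of _ \<delta>] conjI \<delta> allI impI)
    fix J :: "'a set" and x y
    assume "finite J \<and> (\<forall>j\<in>J. c \<le> x j \<and> x j \<le> y j \<and> y j \<le> d) \<and>
      disjoint_family_on (\<lambda>j. {x j<..<y j}) J \<and> (\<Sum>j\<in>J. y j - x j) < \<delta>"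
    then have J: "finite J" "\<forall>j\<in>J. c \<le> x j \<and> x j \<le> y j \<and> y j \<le> d"
      "disjoint_family_on (\<lambda>j. {x j<..<y j}) J" "(\<Sum>j\<in>J. y j - x j) < \<delta>"
      by auto
    obtain \<pi> where "bij_betw \<pi> {0..<card J} J"
      using ex_bij_betw_nat_finite[OF J(1)] by blast
    then have \<pi>: "bij_betw \<pi> {..<card J} J" by (simp add: lessThan_atLeast0)
    then have \<pi>J: "\<pi> i \<in> J" if "i < card J" for i
      using that by (auto simp: bij_betw_def)
    have sum: "(\<Sum>j\<in>J. F j) = (\<Sum>i<card J. F (\<pi> i))" for F :: "'a \<Rightarrow> real"
      by (rule sum.reindex_bij_betw[OF \<pi>, symmetric])
    have "disjoint_family_on (\<lambda>i. {x (\<pi> i)<..<y (\<pi> i)}) {..<card J}"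
      using J(3) \<pi> unfolding disjoint_family_on_def bij_betw_def inj_on_def by blast
    then show "(\<Sum>j\<in>J. \<bar>f (y j) - f (x j)\<bar>) < e"
      unfolding sum using J(2,4) \<pi>J by (intro *) (auto simp: sum)
  qed
qed

text \<open>Continuity is absolute continuity for a single interval, whence the one-element index
  type \<open>unit\<close>.\<close>

lemma AC_on_continuous_on:
  assumes "AC_on c d f"
  shows "continuous_on {c..d} f"
  unfolding continuous_on_iff
proof (intro ballI allI impI)
  fix x e :: real assume x: "x \<in> {c..d}" and "e > 0"
  then obtain \<delta> where \<delta>: "\<delta> > 0" and
    *: "\<forall>J x y. finite (J :: unit set) \<and> (\<forall>j\<in>J. c \<le> x j \<and> x j \<le> y j \<and> y j \<le> d) \<and>
        disjoint_family_on (\<lambda>j. {x j<..<y j}) J \<and>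
        (\<Sum>j\<in>J. y j - x j) < \<delta> \<longrightarrow> (\<Sum>j\<in>J. \<bar>f (y j) - f (x j)\<bar>) < e"
    using AC_on_finite_set[OF assms] by blast
  have **: "\<bar>f v - f u\<bar> < e" if "c \<le> u" "u \<le> v" "v \<le> d" "v - u < \<delta>" for u v
    using *[rule_format, of "{()}" "\<lambda>_. u" "\<lambda>_. v"] that by (simp add: disjoint_family_on_def)
  show "\<exists>\<delta>>0. \<forall>y\<in>{c..d}. dist y x < \<delta> \<longrightarrow> dist (f y) (f x) < e"
  proof (intro exI[of _ \<delta>] conjI \<delta> ballI impI)
    fix y assume "y \<in> {c..d}" "dist y x < \<delta>"
    then show "dist (f y) (f x) < e"
      using x **[of x y] **[of y x] by (cases "x \<le> y") (auto simp: dist_real_def abs_minus_commute)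
  qed
qed

section \<open>Closure properties of absolute continuity\<close>

text \<open>Common source of the closure under differences, products and reciprocals: one family of
  intervals is tested on \<open>f\<close> and \<open>g\<close> simultaneously, and the bound on
  increments is summed.\<close>

lemma AC_on_dominated:
  assumes f: "AC_on c d f" and g: "AC_on c d g"
    and h: "\<And>x y. x \<in> {c..d} \<Longrightarrow> y \<in> {c..d} \<Longrightarrow>
              \<bar>h y - h x\<bar> \<le> B * (\<bar>f y - f x\<bar> + \<bar>g y - g x\<bar>)"
  shows "AC_on c d h"
  unfolding AC_on_def
proof (intro allI impI)
  fix e :: real assume e: "e > 0"
  \<comment> \<open>\<open>B\<close> may be zero or negative; \<open>C\<close> is a positive upper
    bound for it, so that \<open>e / (2 * C)\<close> is a legitimate tolerance for each of
    \<open>f\<close> and \<open>g\<close>.\<close>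
  define C where "C = \<bar>B\<bar> + 1"
  have C: "C > 0" "B \<le> C" by (auto simp: C_def)
  then have e': "e / (2 * C) > 0" using e by simp
  obtain \<delta>1 where \<delta>1: "\<delta>1 > 0" and
    1: "\<And>(n::nat) x y. (\<forall>i<n. c \<le> x i \<and> x i \<le> y i \<and> y i \<le> d) \<Longrightarrow>
        disjoint_family_on (\<lambda>i. {x i<..<y i}) {..<n} \<Longrightarrow>
        (\<Sum>i<n. y i - x i) < \<delta>1 \<Longrightarrow> (\<Sum>i<n. \<bar>f (y i) - f (x i)\<bar>) < e / (2 * C)"
    using f e' unfolding AC_on_def by meson
  obtain \<delta>2 where \<delta>2: "\<delta>2 > 0" and
    2: "\<And>(n::nat) x y. (\<forall>i<n. c \<le> x i \<and> x i \<le> y i \<and> y i \<le> d) \<Longrightarrow>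
        disjoint_family_on (\<lambda>i. {x i<..<y i}) {..<n} \<Longrightarrow>
        (\<Sum>i<n. y i - x i) < \<delta>2 \<Longrightarrow> (\<Sum>i<n. \<bar>g (y i) - g (x i)\<bar>) < e / (2 * C)"
    using g e' unfolding AC_on_def by meson
  show "\<exists>\<delta>>0. \<forall>(n::nat) x y.
        (\<forall>i<n. c \<le> x i \<and> x i \<le> y i \<and> y i \<le> d) \<and>
        disjoint_family_on (\<lambda>i. {x i<..<y i}) {..<n} \<and>
        (\<Sum>i<n. y i - x i) < \<delta> \<longrightarrow> (\<Sum>i<n. \<bar>h (y i) - h (x i)\<bar>) < e"
  proof (intro exI[of _ "min \<delta>1 \<delta>2"] conjI allI impI)
    show "min \<delta>1 \<delta>2 > 0" using \<delta>1 \<delta>2 by simp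
    fix n :: nat and x y
    assume A: "(\<forall>i<n. c \<le> x i \<and> x i \<le> y i \<and> y i \<le> d) \<and>
        disjoint_family_on (\<lambda>i. {x i<..<y i}) {..<n} \<and> (\<Sum>i<n. y i - x i) < min \<delta>1 \<delta>2"
    have "(\<Sum>i<n. \<bar>h (y i) - h (x i)\<bar>) \<le> (\<Sum>i<n. C * (\<bar>f (y i) - f (x i)\<bar> + \<bar>g (y i) - g (x i)\<bar>))"
    proof (rule sum_mono)
      fix i assume "i \<in> {..<n}"
      then have "c \<le> x i" "x i \<le> y i" "y i \<le> d" using A by auto
      then have "\<bar>h (y i) - h (x i)\<bar> \<le> B * (\<bar>f (y i) - f (x i)\<bar> + \<bar>g (y i) - g (x i)\<bar>)"
        by (intro h) auto
      also have "\<dots> \<le> C * (\<bar>f (y i) - f (x i)\<bar> + \<bar>g (y i) - g (x i)\<bar>)"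
        by (intro mult_right_mono C) auto
      finally show "\<bar>h (y i) - h (x i)\<bar> \<le> C * (\<bar>f (y i) - f (x i)\<bar> + \<bar>g (y i) - g (x i)\<bar>)" .
    qed
    also have "\<dots> = C * ((\<Sum>i<n. \<bar>f (y i) - f (x i)\<bar>) + (\<Sum>i<n. \<bar>g (y i) - g (x i)\<bar>))"
      by (simp add: sum_distrib_left[symmetric] sum.distrib)
    also have "\<dots> < C * (e / (2 * C) + e / (2 * C))"
      using A by (intro mult_strict_left_mono add_strict_mono 1 2 C) auto
    also have "\<dots> = e" using C by (simp add: field_simps)
    finally show "(\<Sum>i<n. \<bar>h (y i) - h (x i)\<bar>) < e" .
  qed
qed

lemma AC_on_bounded:
  assumes "AC_on c d f"
  obtains B where "\<And>x. x \<in> {c..d} \<Longrightarrow> \<bar>f x\<bar> \<le> B"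
proof -
  have "bounded (f ` {c..d})"
    using AC_on_continuous_on[OF assms] compact_continuous_image compact_imp_bounded by blast
  then obtain B where "\<forall>x\<in>{c..d}. \<bar>f x\<bar> \<le> B"
    unfolding bounded_iff by (metis image_eqI real_norm_def)
  then show thesis by (intro that) blast
qed

lemma AC_on_diff:
  assumes "AC_on c d f" "AC_on c d g"
  shows "AC_on c d (\<lambda>x. f x - g x)"
  by (rule AC_on_dominated[OF assms, where B = 1]) auto

lemma AC_on_mult:
  assumes "AC_on c d f" "AC_on c d g"
  shows "AC_on c d (\<lambda>x. f x * g x)"
proof -
  obtain A B where A: "\<And>x. x \<in> {c..d} \<Longrightarrow> \<bar>f x\<bar> \<le> A"
    and B: "\<And>x. x \<in> {c..d} \<Longrightarrow> \<bar>g x\<bar> \<le> B"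
    using AC_on_bounded[OF assms(1)] AC_on_bounded[OF assms(2)] by metis
  show ?thesis
  proof (rule AC_on_dominated[OF assms, where B = "max A B"])
    fix x y assume x: "x \<in> {c..d}" and y: "y \<in> {c..d}"
    have "\<bar>f y * g y - f x * g x\<bar> = \<bar>f y * (g y - g x) + g x * (f y - f x)\<bar>"
      by (simp add: algebra_simps)
    also have "\<dots> \<le> \<bar>f y\<bar> * \<bar>g y - g x\<bar> + \<bar>g x\<bar> * \<bar>f y - f x\<bar>"
      by (metis abs_mult abs_triangle_ineq)
    also have "\<dots> \<le> max A B * \<bar>g y - g x\<bar> + max A B * \<bar>f y - f x\<bar>"
      using A[OF y] B[OF x] by (intro add_mono mult_right_mono) auto
    finally show "\<bar>f y * g y - f x * g x\<bar> \<le> max A B * (\<bar>f y - f x\<bar> + \<bar>g y - g x\<bar>)"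
      by (simp add: algebra_simps)
  qed
qed

text \<open>By compactness a continuous function without zeros has a bounded reciprocal, so
  increments of the reciprocal are at most \<open>B * B\<close> times those of
  \<open>f\<close>.\<close>

lemma AC_on_inverse:
  assumes f: "AC_on c d f" and nz: "\<And>x. x \<in> {c..d} \<Longrightarrow> f x \<noteq> 0"
  shows "AC_on c d (\<lambda>x. inverse (f x))"
proof -
  have "continuous_on {c..d} (\<lambda>x. inverse (f x))"
    using AC_on_continuous_on[OF f] nz by (intro continuous_on_inverse) auto
  then have "bounded ((\<lambda>x. inverse (f x)) ` {c..d})"
    using compact_continuous_image compact_imp_bounded by blast
  then obtain B where B: "\<And>x. x \<in> {c..d} \<Longrightarrow> \<bar>inverse (f x)\<bar> \<le> B"
    unfolding bounded_iff by (metis image_eqI real_norm_def)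
  show ?thesis
  proof (rule AC_on_dominated[OF f f, where B = "B * B"])
    fix x y assume x: "x \<in> {c..d}" and y: "y \<in> {c..d}"
    have B0: "0 \<le> B" using B[OF x] by linarith
    have "inverse (f y) - inverse (f x) = - (inverse (f y) * (f y - f x) * inverse (f x))"
      using nz[OF x] nz[OF y] by (rule inverse_diff_inverse[rotated])
    then have "\<bar>inverse (f y) - inverse (f x)\<bar> = (\<bar>inverse (f y)\<bar> * \<bar>inverse (f x)\<bar>) * \<bar>f y - f x\<bar>"
      by (simp add: abs_mult)
    also have "\<dots> \<le> (B * B) * \<bar>f y - f x\<bar>"
      using B[OF x] B[OF y] B0 by (intro mult_right_mono mult_mono) auto
    also have "\<dots> \<le> (B * B) * (\<bar>f y - f x\<bar> + \<bar>f y - f x\<bar>)"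
      using B0 by (intro mult_left_mono) auto
    finally show "\<bar>inverse (f y) - inverse (f x)\<bar> \<le> (B * B) * (\<bar>f y - f x\<bar> + \<bar>f y - f x\<bar>)" .
  qed
qed

section \<open>Integrating the derivative\<close>

text \<open>
  A Riemann sum over a fine tagged division is compared with the telescoping sum of the increments
  of \<open>f\<close>: at tags where \<open>f\<close> is differentiable this is the definition of the derivative, and the
  intervals tagged in the exceptional null set lie in an open set of small measure, so that
  absolute continuity applies.
\<close>

lemma AC_on_has_integral:
  assumes ac: "AC_on c d f" and "c \<le> d"
    and ae: "AE x\<in>{c<..<d} in lebesgue. (f has_real_derivative f' x) (at x)"
  shows "(f' has_integral (f d - f c)) {c..d}"
proof -
  \<comment> \<open>Differentiability is assumed only inside the interval; the end points may join
    the exceptional set, which stays null.\<close>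
  define N where "N = {x \<in> {c..d}. \<not> (f has_real_derivative f' x) (at x)}"
  have "N \<subseteq> {x \<in> {c<..<d}. \<not> (f has_real_derivative f' x) (at x)} \<union> {c, d}"
    by (auto simp: N_def)
  moreover have "negligible ({x \<in> {c<..<d}. \<not> (f has_real_derivative f' x) (at x)} \<union> {c, d})"
    using ae unfolding AE_lebesgue_on_iff_negligible by (intro negligible_Un) auto
  ultimately have N: "negligible N" by (rule negligible_subset[rotated])
  \<comment> \<open>With the value 0 on \<open>N\<close>, a tag in \<open>N\<close> contributes
    nothing to the Riemann sum and leaves only an increment of \<open>f\<close>.\<close>
  define g where "g x = (if x \<in> N then 0 else f' x)" for x
  have "(g has_integral (f d - f c)) {c..d}"
    unfolding has_integral_real
  proof (intro allI impI)
    fix e :: real assume e: "e > 0"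
    \<comment> \<open>Half of the error \<open>e\<close> is reserved for the tags outside
      \<open>N\<close>. The summand 1 keeps the denominator positive when
      \<open>c = d\<close>.\<close>
    define \<epsilon> where "\<epsilon> = e / (2 * (d - c + 1))"
    have \<epsilon>: "\<epsilon> > 0" "\<epsilon> * (d - c) \<le> e / 2"
      using e \<open>c \<le> d\<close> by (auto simp: \<epsilon>_def field_simps)
    obtain \<delta> where \<delta>: "\<delta> > 0" and
      ac': "\<forall>J x y. finite (J :: (real \<times> real set) set) \<and>
        (\<forall>j\<in>J. c \<le> x j \<and> x j \<le> y j \<and> y j \<le> d) \<and>
        disjoint_family_on (\<lambda>j. {x j<..<y j}) J \<and>
        (\<Sum>j\<in>J. y j - x j) < \<delta> \<longrightarrow> (\<Sum>j\<in>J. \<bar>f (y j) - f (x j)\<bar>) < e / 2"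
      using AC_on_finite_set[OF ac half_gt_zero[OF e]] by blast
    \<comment> \<open>Outer regularity: the null set \<open>N\<close> has an open neighbourhood of
      measure below the \<open>\<delta>\<close> of absolute continuity.\<close>
    obtain U where U: "open U" "N \<subseteq> U" "U \<in> lmeasurable" "measure lebesgue U < \<delta>"
    proof -
      have "N \<in> sets lebesgue" using N negligible_imp_sets by blast
      then obtain T where T: "open T" "N \<subseteq> T" "T - N \<in> lmeasurable" "emeasure lebesgue (T - N) < ennreal \<delta>"
        using sets_lebesgue_outer_open[OF _ \<delta>] by metis
      have "T = (T - N) \<union> N" using T by auto
      then have "T \<in> lmeasurable" "measure lebesgue T = measure lebesgue (T - N)"
        using T(3) N by (metis fmeasurable.Un negligible_imp_measurable)
          (metis T(3) N measure_Un_null_set fmeasurableD negligible_iff_null_sets \<open>T = (T - N) \<union> N\<close>)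
      moreover have "measure lebesgue (T - N) < \<delta>"
        using T(3,4) \<delta> by (simp add: emeasure_eq_measure2 ennreal_less_iff)
      ultimately show thesis using that T by metis
    qed
    have "\<exists>\<eta>>0. \<forall>y. \<bar>y - x\<bar> < \<eta> \<longrightarrow> \<bar>f y - f x - f' x * (y - x)\<bar> \<le> \<epsilon> * \<bar>y - x\<bar>"
      if "x \<in> {c..d} - N" for x
    proof -
      have "(f has_derivative (\<lambda>h. f' x * h)) (at x)"
        using that by (auto simp: N_def has_field_derivative_def)
      then show ?thesis
        using \<epsilon>(1) unfolding has_derivative_at_alt by auto
    qed
    then obtain \<eta> where \<eta>: "\<And>x. x \<in> {c..d} - N \<Longrightarrow> \<eta> x > 0"
      and \<eta>': "\<And>x y. x \<in> {c..d} - N \<Longrightarrow> \<bar>y - x\<bar> < \<eta> x \<Longrightarrow> \<bar>f y - f x - f' x * (y - x)\<bar> \<le> \<epsilon> * \<bar>y - x\<bar>"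
      by metis
    \<comment> \<open>The gauge confines intervals tagged in \<open>N\<close> to \<open>U\<close>,
      and the others to balls on which the linear approximation at the tag has error at most
      \<open>\<epsilon> * \<bar>y - x\<bar>\<close>.\<close>
    define \<gamma> where "\<gamma> x = (if x \<in> N then U else if x \<in> {c..d} then ball x (\<eta> x) else UNIV)" for x
    have "gauge \<gamma>"
      using U \<eta> by (auto simp: gauge_def \<gamma>_def)
    moreover have "norm ((\<Sum>(x, K)\<in>\<D>. measure lborel K *\<^sub>R g x) - (f d - f c)) < e"
      if tag: "\<D> tagged_division_of {c..d}" and fine: "\<gamma> fine \<D>" for \<D>
    proof -
      note D = tagged_division_ofD[OF tag]
      have K: "\<exists>u v. K = {u..v} \<and> u \<le> x \<and> x \<le> v \<and> c \<le> u \<and> v \<le> d" if xK: "(x, K) \<in> \<D>" for x K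
      proof -
        obtain u v where "K = {u..v}" using D(4)[OF xK] by auto
        moreover have "x \<in> K" "K \<subseteq> {c..d}" using D(2,3) xK by auto
        ultimately show ?thesis by auto
      qed
      define B where "B = {z \<in> \<D>. fst z \<in> N}"
      have finB: "finite B" "finite \<D>" using D(1) by (auto simp: B_def)
      \<comment> \<open>The intervals tagged in \<open>N\<close> have disjoint interiors contained
        in \<open>U\<close>. Their total length is therefore below \<open>\<delta>\<close>, and
        absolute continuity bounds the increments.\<close>
      have bad: "(\<Sum>z\<in>B. \<bar>f (Sup (snd z)) - f (Inf (snd z))\<bar>) < e / 2"
      proof -
        have intr: "interior (snd z) = {Inf (snd z)<..<Sup (snd z)}" if "z \<in> B" for z
          using K[of "fst z" "snd z"] that by (auto simp: B_def)
        have ends: "c \<le> Inf (snd z) \<and> Inf (snd z) \<le> Sup (snd z) \<and> Sup (snd z) \<le> d" if "z \<in> B" for z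
          using K[of "fst z" "snd z"] that by (auto simp: B_def)
        have disj: "interior (snd z) \<inter> interior (snd z') = {}" if "z \<in> B" "z' \<in> B" "z \<noteq> z'" for z z'
          using D(5)[of "fst z" "snd z" "fst z'" "snd z'"] that by (auto simp: B_def)
        have family: "disjoint_family_on (\<lambda>z. {Inf (snd z)<..<Sup (snd z)}) B"
          using disj intr by (simp add: disjoint_family_on_def)
        have "(\<Sum>z\<in>B. Sup (snd z) - Inf (snd z)) = (\<Sum>z\<in>B. measure lebesgue {Inf (snd z)<..<Sup (snd z)})"
        proof (rule sum.cong[OF refl])
          fix z assume "z \<in> B"
          then show "Sup (snd z) - Inf (snd z) = measure lebesgue {Inf (snd z)<..<Sup (snd z)}"
            using K[of "fst z" "snd z"] by (auto simp: B_def)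
        qed
        also have "\<dots> = measure lebesgue (\<Union>z\<in>B. {Inf (snd z)<..<Sup (snd z)})"
          by (rule measure_UNION'[symmetric])
             (use finB disj intr in \<open>auto simp: pairwise_def disjnt_def\<close>)
        also have "\<dots> \<le> measure lebesgue U"
        proof (rule measure_mono_fmeasurable)
          have "interior (snd z) \<subseteq> U" if "z \<in> B" for z
          proof -
            have "snd z \<subseteq> \<gamma> (fst z)"
              using fineD[OF fine, of "fst z" "snd z"] that by (simp add: B_def)
            then show ?thesis
              using that interior_subset[of "snd z"] by (auto simp: B_def \<gamma>_def)
          qed
          then show "(\<Union>z\<in>B. {Inf (snd z)<..<Sup (snd z)}) \<subseteq> U" using intr by blast
        qed (use U finB in auto)
        also have "\<dots> < \<delta>" by (rule U)
        finally have "(\<Sum>z\<in>B. Sup (snd z) - Inf (snd z)) < \<delta>" .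
        then show ?thesis
          using ac'[rule_format, of B "\<lambda>z. Inf (snd z)" "\<lambda>z. Sup (snd z)"] finB ends family by blast
      qed
      \<comment> \<open>The tag lies between the end points, so the errors on its two sides,
        \<open>\<epsilon> * (x - u)\<close> and \<open>\<epsilon> * (v - x)\<close>, add up to
        \<open>\<epsilon>\<close> times the length of the interval.\<close>
      have good: "\<bar>measure lborel K * g x - (f (Sup K) - f (Inf K))\<bar> \<le> \<epsilon> * measure lborel K"
        if xK: "(x, K) \<in> \<D>" and "x \<notin> N" for x K
      proof -
        obtain u v where uv: "K = {u..v}" "u \<le> x" "x \<le> v" "c \<le> u" "v \<le> d" using K[OF xK] by blast
        then have x: "x \<in> {c..d} - N" using \<open>x \<notin> N\<close> by auto
        have "K \<subseteq> ball x (\<eta> x)" using fineD[OF fine xK] x by (simp add: \<gamma>_def)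
        moreover have "u \<in> K" "v \<in> K" using uv by auto
        ultimately have "\<bar>u - x\<bar> < \<eta> x" "\<bar>v - x\<bar> < \<eta> x"
          by (auto simp: dist_real_def subset_iff abs_minus_commute)
        then have "\<bar>f u - f x - f' x * (u - x)\<bar> \<le> \<epsilon> * (x - u)" "\<bar>f v - f x - f' x * (v - x)\<bar> \<le> \<epsilon> * (v - x)"
          using \<eta>'[OF x, of u] \<eta>'[OF x, of v] uv by auto
        moreover have "(v - u) * f' x - (f v - f u) =
            (f u - f x - f' x * (u - x)) - (f v - f x - f' x * (v - x))"
          by (simp add: algebra_simps)
        ultimately have "\<bar>(v - u) * f' x - (f v - f u)\<bar> \<le> \<epsilon> * (x - u) + \<epsilon> * (v - x)"
          by linarith
        also have "\<dots> = \<epsilon> * (v - u)" by (simp add: algebra_simps)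
        finally show ?thesis using uv \<open>x \<notin> N\<close> by (simp add: g_def)
      qed
      \<comment> \<open>The increments of \<open>f\<close> over the division telescope to
        \<open>f d - f c\<close>, so the error splits into one term for each tagged
        interval.\<close>
      have "(\<Sum>(x, K)\<in>\<D>. measure lborel K *\<^sub>R g x) - (f d - f c) =
          (\<Sum>(x, K)\<in>\<D>. measure lborel K * g x - (f (Sup K) - f (Inf K)))"
        using additive_tagged_division_1[OF \<open>c \<le> d\<close> tag, of f]
        by (simp add: split_def sum_subtractf)
      also have "\<bar>\<dots>\<bar> \<le> (\<Sum>z\<in>\<D>. \<bar>measure lborel (snd z) * g (fst z) - (f (Sup (snd z)) - f (Inf (snd z)))\<bar>)"
        unfolding split_def by (rule sum_abs)
      also have "\<dots> = (\<Sum>z\<in>\<D> - B. \<bar>measure lborel (snd z) * g (fst z) - (f (Sup (snd z)) - f (Inf (snd z)))\<bar>)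
          + (\<Sum>z\<in>B. \<bar>measure lborel (snd z) * g (fst z) - (f (Sup (snd z)) - f (Inf (snd z)))\<bar>)"
        by (rule sum.subset_diff) (use finB in \<open>auto simp: B_def\<close>)
      also have "\<dots> \<le> (\<Sum>z\<in>\<D> - B. \<epsilon> * measure lborel (snd z)) + (\<Sum>z\<in>B. \<bar>f (Sup (snd z)) - f (Inf (snd z))\<bar>)"
        by (intro add_mono sum_mono) (use good in \<open>auto simp: B_def g_def\<close>)
      also have "(\<Sum>z\<in>\<D> - B. \<epsilon> * measure lborel (snd z)) \<le> (\<Sum>z\<in>\<D>. \<epsilon> * measure lborel (snd z))"
        by (rule sum_mono2) (use finB \<epsilon> in auto)
      also have "\<dots> = \<epsilon> * (d - c)"
        using additive_content_tagged_division[of \<D> c d] tag \<open>c \<le> d\<close>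
        by (simp add: sum_distrib_left[symmetric] split_def)
      finally show ?thesis using bad \<epsilon>(2) by simp
    qed
    ultimately show "\<exists>\<gamma>. gauge \<gamma> \<and> (\<forall>\<D>. \<D> tagged_division_of {c..d} \<and> \<gamma> fine \<D> \<longrightarrow>
        norm ((\<Sum>(x, K)\<in>\<D>. measure lborel K *\<^sub>R g x) - (f d - f c)) < e)"
      by metis
  qed
  then show ?thesis
    by (rule has_integral_spike[OF N, rotated]) (simp add: g_def)
qed

text \<open>The increment is the integral of an almost everywhere positive function; if it were
  zero, that function would vanish almost everywhere on an interval of positive length.\<close>

lemma AC_on_strict_increase:
  assumes ac: "AC_on c d f" and "c < d"
    and der: "AE x\<in>{c<..<d} in lebesgue. (f has_real_derivative f' x) (at x)"
    and pos: "AE x\<in>{c<..<d} in lebesgue. f' x > 0"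
  shows "f c < f d"
proof -
  define N where "N = {x \<in> {c<..<d}. \<not> f' x > 0} \<union> {c, d}"
  \<comment> \<open>The value 1 on the null set makes \<open>g\<close> positive at every point of
    the closed interval.\<close>
  define g where "g x = (if x \<in> N then 1 else f' x)" for x
  have "negligible N"
    using pos unfolding N_def AE_lebesgue_on_iff_negligible by (intro negligible_Un) auto
  then have g: "(g has_integral (f d - f c)) {c..d}"
    by (rule has_integral_spike[OF _ _ AC_on_has_integral[OF ac _ der]])
       (use \<open>c < d\<close> in \<open>auto simp: g_def\<close>)
  have g_pos: "g x > 0" if "x \<in> {c..d}" for x
    using that by (auto simp: g_def N_def)
  have "f d - f c \<ge> 0"
    using has_integral_nonneg[OF g] g_pos by (simp add: less_imp_le)
  moreover have "f d - f c \<noteq> 0"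
  proof
    assume 0: "f d - f c = 0"
    \<comment> \<open>A nonnegative gauge integrable function is Lebesgue integrable, so a zero
      integral forces it to vanish almost everywhere.\<close>
    have int: "set_integrable lebesgue {c..d} g"
      using nonnegative_absolutely_integrable_1[of g "{c..d}"] g g_pos
      by (auto simp: integrable_on_def less_imp_le)
    have "(LINT x:{c..d}|lebesgue. g x) = 0"
      using set_lebesgue_integral_eq_integral(2)[OF int] g 0 by (simp add: integral_unique)
    then have "AE x in lebesgue. indicator {c..d} x *\<^sub>R g x = 0"
      using int g_pos unfolding set_integrable_def set_lebesgue_integral_def
      by (subst (asm) integral_nonneg_eq_0_iff_AE) (auto simp: indicator_def less_imp_le)
    then have "AE x\<in>{c..d} in lebesgue. False"
      by eventually_elim (use g_pos in \<open>force simp: indicator_def\<close>)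
    then have "negligible {x \<in> {c..d}. \<not> False}"
      by (rule AE_lebesgue_on_iff_negligible[THEN iffD1])
    moreover have "{x \<in> {c..d}. \<not> False} = {c..d}" by auto
    ultimately have "negligible {c..d}" by (simp only:)
    then show False
      using negligible_interval(1)[of c d] \<open>c < d\<close> by simp
  qed
  ultimately show ?thesis by simp
qed

text \<open>The increment is the integral of \<open>f'\<close> between the two points. As
  \<open>k\<close> is nonnegative, enlarging the domain to the whole interval gives a bound
  independent of the points, as the uniqueness argument requires.\<close>

lemma AC_on_abs_diff_le:
  assumes ac: "AC_on c d f"
    and der: "AE x\<in>{c<..<d} in lebesgue. (f has_real_derivative f' x) (at x)"
    and le: "AE x\<in>{c<..<d} in lebesgue. \<bar>f' x\<bar> \<le> k x"
    and k: "k integrable_on {c..d}" "\<And>x. k x \<ge> 0"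
    and xy: "x \<in> {c..d}" "y \<in> {c..d}"
  shows "\<bar>f y - f x\<bar> \<le> integral {c..d} k"
proof -
  define N where "N = {x \<in> {c<..<d}. \<not> \<bar>f' x\<bar> \<le> k x} \<union> {c, d}"
  define g where "g x = (if x \<in> N then 0 else f' x)" for x
  have N: "negligible N"
    using le unfolding N_def AE_lebesgue_on_iff_negligible by (intro negligible_Un) auto
  have "\<bar>f y - f x\<bar> \<le> integral {c..d} k" if "x \<le> y" "c \<le> x" "y \<le> d" for x y
  proof -
    have "AC_on x y f" using AC_on_mono[OF ac] that by simp
    moreover have "AE t\<in>{x<..<y} in lebesgue. (f has_real_derivative f' t) (at t)"
      using der by eventually_elim (use that in auto)
    ultimately have "(f' has_integral (f y - f x)) {x..y}"
      using AC_on_has_integral that by blast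
    then have g: "(g has_integral (f y - f x)) {x..y}"
      by (rule has_integral_spike[OF N, rotated]) (simp add: g_def)
    have kxy: "k integrable_on {x..y}"
      by (rule integrable_on_subinterval[OF k(1)]) (use that in auto)
    have "\<bar>integral {x..y} g\<bar> \<le> integral {x..y} k"
      unfolding real_norm_def[symmetric]
    proof (rule Henstock_Kurzweil_Integration.integral_norm_bound_integral)
      show "norm (g t) \<le> k t" if "t \<in> {x..y}" for t
        using that \<open>c \<le> x\<close> \<open>y \<le> d\<close> k(2)[of t] by (auto simp: g_def N_def)
    qed (use g kxy in auto)
    also have "\<dots> \<le> integral {c..d} k"
      by (rule integral_subset_le) (use that k kxy in auto)
    finally show ?thesis using g by (simp add: integral_unique)
  qed
  from this[of x y] this[of y x] xy show ?thesis
    by (cases "x \<le> y") (auto simp: abs_minus_commute)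
qed

lemma locally_integrable_integrable_on:
  assumes "locally_integrable I f" "{c..d} \<subseteq> I"
  shows "(\<lambda>x. \<bar>f x\<bar>) integrable_on {c..d}"
proof -
  have "f absolutely_integrable_on {c..d}"
    using assms unfolding locally_integrable_def by simp
  then show ?thesis
    by (simp add: absolutely_integrable_on_def)
qed

section \<open>The first-order system\<close>

text \<open>
  The equation \<open>(\<tau> - \<lambda>)u = 0\<close> as a first-order system in \<open>u\<close> and \<open>g = u\<^sup>[\<^sup>1\<^sup>]\<close>, with
  \<open>w = 1 / p\<close> and \<open>v = q - \<lambda> r\<close>.
\<close>

definition sl_system ::
  "real set \<Rightarrow> (real \<Rightarrow> real) \<Rightarrow> (real \<Rightarrow> real) \<Rightarrow> (real \<Rightarrow> real) \<Rightarrow> (real \<Rightarrow> real) \<Rightarrow> (real \<Rightarrow> real) \<Rightarrow> bool" where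
  "sl_system I w s v u g \<longleftrightarrow> AC_loc I u \<and> AC_loc I g \<and>
     (AE x\<in>I in lebesgue. (u has_real_derivative (w x * g x - s x * u x)) (at x) \<and>
        (g has_real_derivative (s x * g x + v x * u x)) (at x))"

lemma sl_system_AC_on:
  assumes "sl_system I w s v u g" "{c..d} \<subseteq> I"
  shows "AC_on c d u" "AC_on c d g"
  using assms by (auto simp: sl_system_def AC_loc_def)

lemma sl_system_derivative:
  assumes "sl_system I w s v u g" "J \<subseteq> I"
  shows "AE x\<in>J in lebesgue. (u has_real_derivative (w x * g x - s x * u x)) (at x) \<and>
           (g has_real_derivative (s x * g x + v x * u x)) (at x)"
proof -
  have "AE x\<in>I in lebesgue. (u has_real_derivative (w x * g x - s x * u x)) (at x) \<and>
           (g has_real_derivative (s x * g x + v x * u x)) (at x)"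
    using assms(1) by (simp add: sl_system_def)
  then show ?thesis by eventually_elim (use assms(2) in auto)
qed

text \<open>Off a null set \<open>p\<close> and \<open>r\<close> do not vanish, so the formula for
  the quasi-derivative can be solved for \<open>u'\<close> and the equation
  \<open>\<tau>u = \<lambda>u\<close> for the derivative of \<open>g\<close>.\<close>

lemma solution_imp_sl_system:
  assumes "solution I p q r s lam u"
    and r: "AE x\<in>I in lebesgue. r x > 0" and p: "AE x\<in>I in lebesgue. p x \<noteq> 0"
  shows "\<exists>g. sl_system I (\<lambda>x. 1 / p x) s (\<lambda>x. q x - lam * r x) u g"
proof -
  from assms(1) obtain g g' u' where u: "AC_loc I u" and g: "AC_loc I g"
    and u': "AE x\<in>I in lebesgue. (u has_real_derivative u' x) (at x)"
    and u'': "AE x\<in>I in lebesgue. g x = p x * (u' x + s x * u x)"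
    and g': "AE x\<in>I in lebesgue. (g has_real_derivative g' x) (at x)"
    and g'': "AE x\<in>I in lebesgue. lam * u x = 1 / r x * (- g' x + s x * g x + q x * u x)"
    unfolding solution_def tau_graph_def tau_domain_def quasi_derivative_def has_ae_derivative_def
    by blast
  have "AE x\<in>I in lebesgue. (u has_real_derivative (1 / p x * g x - s x * u x)) (at x) \<and>
        (g has_real_derivative (s x * g x + (q x - lam * r x) * u x)) (at x)"
    using u' u'' g' g'' r p
  proof eventually_elim
    fix x
    assume A: "x \<in> I \<longrightarrow> (u has_real_derivative u' x) (at x)"
      "x \<in> I \<longrightarrow> g x = p x * (u' x + s x * u x)"
      "x \<in> I \<longrightarrow> (g has_real_derivative g' x) (at x)"
      "x \<in> I \<longrightarrow> lam * u x = 1 / r x * (- g' x + s x * g x + q x * u x)"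
      "x \<in> I \<longrightarrow> 0 < r x" "x \<in> I \<longrightarrow> p x \<noteq> 0"
    show "x \<in> I \<longrightarrow> (u has_real_derivative (1 / p x * g x - s x * u x)) (at x) \<and>
        (g has_real_derivative (s x * g x + (q x - lam * r x) * u x)) (at x)"
    proof
      assume "x \<in> I"
      with A have B: "(u has_real_derivative u' x) (at x)" "g x = p x * (u' x + s x * u x)"
        "(g has_real_derivative g' x) (at x)"
        "lam * u x = 1 / r x * (- g' x + s x * g x + q x * u x)" "0 < r x" "p x \<noteq> 0"
        by auto
      have "u' x = 1 / p x * g x - s x * u x"
        using B(6) by (simp add: B(2))
      moreover have "lam * u x * r x = - g' x + s x * g x + q x * u x"
        using B(4,5) by (simp add: field_simps)
      then have "g' x = s x * g x + (q x - lam * r x) * u x"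
        by (simp add: algebra_simps)
      ultimately show "(u has_real_derivative (1 / p x * g x - s x * u x)) (at x) \<and>
        (g has_real_derivative (s x * g x + (q x - lam * r x) * u x)) (at x)"
        using B(1,3) by simp
    qed
  qed
  with u g have "sl_system I (\<lambda>x. 1 / p x) s (\<lambda>x. q x - lam * r x) u g"
    unfolding sl_system_def by blast
  then show ?thesis by blast
qed

section \<open>Uniqueness for the initial value problem\<close>

text \<open>
  With \<open>M\<close> the maximum of \<open>\<bar>u\<bar> + \<bar>g\<bar>\<close>, both components are at most \<open>M / 4\<close>, so \<open>M \<le> M / 2\<close>.
\<close>

lemma sl_system_zero_short_interval:
  assumes sys: "sl_system I w s v u g" and cd: "{c..d} \<subseteq> I"
    and k: "(\<lambda>x. \<bar>w x\<bar> + \<bar>s x\<bar> + \<bar>v x\<bar>) integrable_on {c..d}"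
    and small: "integral {c..d} (\<lambda>x. \<bar>w x\<bar> + \<bar>s x\<bar> + \<bar>v x\<bar>) \<le> 1 / 4"
    and z: "z \<in> {c..d}" "u z = 0" "g z = 0" and x: "x \<in> {c..d}"
  shows "u x = 0" "g x = 0"
proof -
  define k where "k x = \<bar>w x\<bar> + \<bar>s x\<bar> + \<bar>v x\<bar>" for x
  note ac = sl_system_AC_on[OF sys cd]
  have "continuous_on {c..d} (\<lambda>x. \<bar>u x\<bar> + \<bar>g x\<bar>)"
    using ac[THEN AC_on_continuous_on] by (intro continuous_intros)
  then obtain y where y: "y \<in> {c..d}" and max: "\<And>x. x \<in> {c..d} \<Longrightarrow> \<bar>u x\<bar> + \<bar>g x\<bar> \<le> \<bar>u y\<bar> + \<bar>g y\<bar>"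
    using continuous_attains_sup[of "{c..d}" "\<lambda>x. \<bar>u x\<bar> + \<bar>g x\<bar>"] z(1) by auto
  define M where "M = \<bar>u y\<bar> + \<bar>g y\<bar>"
  have M: "0 \<le> M" by (simp add: M_def)
  have bound: "\<bar>w x * g x - s x * u x\<bar> \<le> M * k x" "\<bar>s x * g x + v x * u x\<bar> \<le> M * k x"
    if "x \<in> {c..d}" for x
  proof -
    have "\<bar>u x\<bar> + \<bar>g x\<bar> \<le> M" using max[OF that] by (simp add: M_def)
    then have le: "\<bar>u x\<bar> \<le> M" "\<bar>g x\<bar> \<le> M" by auto
    have "\<bar>w x * g x - s x * u x\<bar> \<le> \<bar>w x\<bar> * \<bar>g x\<bar> + \<bar>s x\<bar> * \<bar>u x\<bar>"
      by (metis abs_mult abs_triangle_ineq4)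
    also have "\<dots> \<le> \<bar>w x\<bar> * M + \<bar>s x\<bar> * M + \<bar>v x\<bar> * M"
      using le M by (simp add: add_mono mult_left_mono add_increasing2)
    finally show "\<bar>w x * g x - s x * u x\<bar> \<le> M * k x" by (simp add: k_def algebra_simps)
    have "\<bar>s x * g x + v x * u x\<bar> \<le> \<bar>s x\<bar> * \<bar>g x\<bar> + \<bar>v x\<bar> * \<bar>u x\<bar>"
      by (metis abs_mult abs_triangle_ineq)
    also have "\<dots> \<le> \<bar>w x\<bar> * M + (\<bar>s x\<bar> * M + \<bar>v x\<bar> * M)"
      using le M by (simp add: add_mono mult_left_mono add_increasing)
    finally show "\<bar>s x * g x + v x * u x\<bar> \<le> M * k x" by (simp add: k_def algebra_simps)
  qed
  have "{c<..<d} \<subseteq> I" using cd by force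
  note AE = sl_system_derivative[OF sys this]
  have der: "AE x\<in>{c<..<d} in lebesgue. (u has_real_derivative (w x * g x - s x * u x)) (at x)"
    "AE x\<in>{c<..<d} in lebesgue. (g has_real_derivative (s x * g x + v x * u x)) (at x)"
    by (use AE in eventually_elim, simp)+
  have Mk: "(\<lambda>x. M * k x) integrable_on {c..d}" "\<And>x. 0 \<le> M * k x"
    using integrable_cmul[OF k, of M] M by (simp_all add: k_def)
  have "integral {c..d} (\<lambda>x. M * k x) = M * integral {c..d} k"
    by simp
  also have "\<dots> \<le> M / 4"
    using mult_left_mono[OF small M] by (simp add: k_def[abs_def])
  finally have int: "integral {c..d} (\<lambda>x. M * k x) \<le> M / 4" .
  \<comment> \<open>Since \<open>u\<close> and \<open>g\<close> vanish at \<open>z\<close>, these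
    increments are the values at the maximum point \<open>y\<close>.\<close>
  have "\<bar>u y - u z\<bar> \<le> integral {c..d} (\<lambda>x. M * k x)"
    by (rule AC_on_abs_diff_le[OF ac(1) der(1) _ Mk z(1) y]) (use bound in auto)
  moreover have "\<bar>g y - g z\<bar> \<le> integral {c..d} (\<lambda>x. M * k x)"
    by (rule AC_on_abs_diff_le[OF ac(2) der(2) _ Mk z(1) y]) (use bound in auto)
  ultimately have "M \<le> M / 2"
    using int z by (simp add: M_def)
  then have "M = 0" using M by simp
  then show "u x = 0" "g x = 0"
    using max[OF x] by (auto simp: M_def)
qed

text \<open>Every point has a neighbourhood on which the coefficients have integral at most 1/4; a
  common zero of \<open>u\<close> and \<open>g\<close> anywhere in it spreads over all of it.
  Connectedness carries this to the whole of \<open>I\<close>.\<close>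

lemma sl_system_unique:
  assumes sys: "sl_system I w s v u g" and I: "open I" "connected I"
    and loc: "locally_integrable I w" "locally_integrable I s" "locally_integrable I v"
    and z: "z \<in> I" "u z = 0" "g z = 0" and x: "x \<in> I"
  shows "u x = 0"
proof -
  define k where "k x = \<bar>w x\<bar> + \<bar>s x\<bar> + \<bar>v x\<bar>" for x
  have k: "k integrable_on {c..d}" if "{c..d} \<subseteq> I" for c d
    unfolding k_def
    by (intro integrable_add locally_integrable_integrable_on[OF _ that] loc)
  have "u x = 0 \<and> g x = 0"
  proof (rule connected_induction_simple[OF I(2) z(1) x])
    show "u z = 0 \<and> g z = 0" using z by simp
    fix t assume t: "t \<in> I"
    then obtain e where e: "e > 0" "cball t e \<subseteq> I"
      using I(1) open_contains_cball by blast
    then have te: "{t - e..t + e} \<subseteq> I" by (simp add: cball_eq_atLeastAtMost)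
    \<comment> \<open>The indefinite integral of \<open>k\<close> is continuous, so it varies by
      less than 1/8 on either side of \<open>t\<close>; together this gives the bound 1/4.\<close>
    define F where "F y = integral {t - e..y} k" for y
    have "continuous_on {t - e..t + e} F"
      unfolding F_def by (rule indefinite_integral_continuous_1[OF k[OF te]])
    then have "\<exists>\<delta>>0. \<forall>y\<in>{t - e..t + e}. dist y t < \<delta> \<longrightarrow> dist (F y) (F t) < 1 / 8"
      unfolding continuous_on_iff
      by (elim ballE[where x = t] allE[where x = "1 / 8"]) (use e(1) in auto)
    then obtain \<delta> where \<delta>: "\<delta> > 0"
      "\<And>y. y \<in> {t - e..t + e} \<Longrightarrow> dist y t < \<delta> \<Longrightarrow> dist (F y) (F t) < 1 / 8"
      by blast
    \<comment> \<open>Halving makes \<open>\<eta>\<close> strictly less than \<open>e\<close> and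
      \<open>\<delta>\<close>, so the end points of the closed interval still satisfy the continuity
      estimate.\<close>
    define \<eta> where "\<eta> = min e \<delta> / 2"
    have \<eta>: "0 < \<eta>" "\<eta> < e" "\<eta> < \<delta>" using e \<delta> by (auto simp: \<eta>_def min_def)
    then have "{t - \<eta>..t + \<eta>} \<subseteq> {t - e..t + e}" by auto
    then have sub: "{t - \<eta>..t + \<eta>} \<subseteq> I" using te by (rule order_trans)
    have te': "{t - e..t + \<eta>} \<subseteq> I" using \<eta> by (intro order_trans[OF _ te]) auto
    have "F (t - \<eta>) + integral {t - \<eta>..t + \<eta>} k = F (t + \<eta>)"
      unfolding F_def
      by (rule Henstock_Kurzweil_Integration.integral_combine[OF _ _ k[OF te']]) (use \<eta> in auto)
    moreover have "dist (F (t + \<eta>)) (F t) < 1 / 8" "dist (F (t - \<eta>)) (F t) < 1 / 8"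
      using \<delta>(2)[of "t + \<eta>"] \<delta>(2)[of "t - \<eta>"] \<eta> by (simp_all add: dist_real_def)
    ultimately have small: "integral {t - \<eta>..t + \<eta>} k \<le> 1 / 4"
      unfolding dist_real_def by linarith
    show "\<exists>T. openin (top_of_set I) T \<and> t \<in> T \<and>
        (\<forall>x\<in>T. \<forall>y\<in>T. u x = 0 \<and> g x = 0 \<longrightarrow> u y = 0 \<and> g y = 0)"
    proof (intro exI[of _ "{t - \<eta><..<t + \<eta>}"] conjI ballI impI)
      show "openin (top_of_set I) {t - \<eta><..<t + \<eta>}"
        unfolding openin_open_eq[OF I(1)]
        by (intro conjI order_trans[OF _ sub]) auto
      show "t \<in> {t - \<eta><..<t + \<eta>}" using \<eta> by simp
      fix x y assume A: "x \<in> {t - \<eta><..<t + \<eta>}" "y \<in> {t - \<eta><..<t + \<eta>}" "u x = 0 \<and> g x = 0"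
      show "u y = 0" "g y = 0"
        using sl_system_zero_short_interval[OF sys sub, of x y]
          k[OF sub] small A by (auto simp: k_def[abs_def])
    qed
  qed
  then show ?thesis by simp
qed

section \<open>The Wronskian and the quotient of two solutions\<close>

lemma is_interval_Icc_subset:
  fixes S :: "real set"
  assumes "is_interval S" "c \<in> S" "d \<in> S"
  shows "{c..d} \<subseteq> S"
  using assms unfolding is_interval_1 by (meson atLeastAtMost_iff subsetI)

text \<open>In the derivative of \<open>W\<close> all terms with \<open>w\<close>, \<open>s\<close>
  and \<open>v\<close> cancel, and an absolutely continuous function with derivative zero almost
  everywhere is constant.\<close>

lemma wronskian_constant:
  assumes sys: "sl_system I w s v u1 g1" "sl_system I w s v u2 g2"
    and I: "is_interval I" and cd: "c \<in> I" "d \<in> I"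
  shows "u1 c * g2 c - g1 c * u2 c = u1 d * g2 d - g1 d * u2 d"
proof -
  define W where "W x = u1 x * g2 x - g1 x * u2 x" for x
  have "W c = W d" if "c \<le> d" "c \<in> I" "d \<in> I" for c d
  proof -
    have sub: "{c..d} \<subseteq> I" using I that by (intro is_interval_Icc_subset)
    have "{c<..<d} \<subseteq> I" by (rule order_trans[OF _ sub]) auto
    note der = sl_system_derivative[OF sys(1) this] sl_system_derivative[OF sys(2) this]
    have "AC_on c d W"
      unfolding W_def
      by (intro AC_on_diff AC_on_mult sl_system_AC_on[OF _ sub]) (fact sys)+
    moreover have "AE x\<in>{c<..<d} in lebesgue. (W has_real_derivative 0) (at x)"
      using der
    proof eventually_elim
      case (elim x)
      then show ?case
        unfolding W_def by (auto intro!: derivative_eq_intros simp: algebra_simps)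
    qed
    ultimately have "((\<lambda>_. 0) has_integral (W d - W c)) {c..d}"
      by (rule AC_on_has_integral[OF _ \<open>c \<le> d\<close>])
    then show ?thesis by simp
  qed
  then have "W c = W d" using cd by (metis linear)
  then show ?thesis by (simp add: W_def)
qed

text \<open>
  The quotient of two solutions has the derivative \<open>- w W / u2\<^sup>2\<close>, where the Wronskian \<open>W\<close> is a
  non-zero constant.
\<close>

lemma sl_quotient_strict_mono:
  assumes sys: "sl_system I w s v u1 g1" "sl_system I w s v u2 g2"
    and I: "open I" "is_interval I"
    and loc: "locally_integrable I w" "locally_integrable I s" "locally_integrable I v"
    and indep: "lin_indep_pair_on I u1 u2"
    and J: "is_interval J" "J \<subseteq> I" and z: "z \<in> J" "u1 z = 0"
    and nz: "\<And>x. x \<in> J \<Longrightarrow> u2 x \<noteq> 0"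
    and T: "\<And>c d. c \<in> J \<Longrightarrow> d \<in> J \<Longrightarrow> AE x\<in>{c<..<d} in lebesgue. T * w x > 0"
  shows "\<exists>\<rho>. strict_mono_on J (\<lambda>x. \<rho> * (u1 x / u2 x))"
proof -
  define W where "W = u1 z * g2 z - g1 z * u2 z"
  have zI: "z \<in> I" using z J by auto
  have W: "u1 x * g2 x - g1 x * u2 x = W" if "x \<in> I" for x
    using wronskian_constant[OF sys I(2) that zI] by (simp add: W_def)
  have "W \<noteq> 0"
  proof
    assume "W = 0"
    then have "g1 z = 0" using z nz by (simp add: W_def)
    then have "\<forall>x\<in>I. u1 x = 0"
      using sl_system_unique[OF sys(1) I(1) _ loc zI] I(2) z(2) is_interval_connected by blast
    then show False
      using indep[unfolded lin_indep_pair_on_def, rule_format, of 1 0] by simp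
  qed
  \<comment> \<open>The factor \<open>\<rho> = - (T * W)\<close> turns the derivative of the
    quotient into \<open>T * w * (W / u2)\<^sup>2\<close>, which is positive whatever the signs of
    \<open>W\<close> and \<open>w\<close>.\<close>
  have "- (T * W) * (u1 c / u2 c) < - (T * W) * (u1 d / u2 d)"
    if "c \<in> J" "d \<in> J" "c < d" for c d
  proof -
    have subJ: "{c..d} \<subseteq> J" using J(1) that by (intro is_interval_Icc_subset)
    then have sub: "{c..d} \<subseteq> I" using J(2) by (rule order_trans)
    have subI: "{c<..<d} \<subseteq> I" by (rule order_trans[OF _ sub]) auto
    note der = sl_system_derivative[OF sys(1) subI] sl_system_derivative[OF sys(2) subI]
    define h where "h x = - (T * W) * (u1 x / u2 x)" for x
    \<comment> \<open>A constant has zero increments, so it is dominated with \<open>B = 0\<close>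
      by any pair of absolutely continuous functions.\<close>
    have const: "AC_on c d (\<lambda>_. - (T * W))"
      by (rule AC_on_dominated[where B = 0, OF sl_system_AC_on[OF sys(1) sub]]) simp
    have "AC_on c d h"
      unfolding h_def divide_inverse
      using subJ by (intro AC_on_mult AC_on_inverse const sl_system_AC_on(1)[OF sys(1) sub]
          sl_system_AC_on(1)[OF sys(2) sub] nz) auto
    moreover have "AE x\<in>{c<..<d} in lebesgue.
        (h has_real_derivative (T * w x * (W / u2 x)\<^sup>2)) (at x)"
      using der
    proof eventually_elim
      case (elim x)
      show ?case
      proof
        assume x: "x \<in> {c<..<d}"
        then have "x \<in> {c..d}" by auto
        then have u2: "u2 x \<noteq> 0" and Wx: "u1 x * g2 x - g1 x * u2 x = W"
          using nz W subJ sub by blast+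
        have "(h has_real_derivative (- (T * W) *
            (((w x * g1 x - s x * u1 x) * u2 x - u1 x * (w x * g2 x - s x * u2 x)) / (u2 x)\<^sup>2))) (at x)"
          unfolding h_def power2_eq_square using elim x u2
          by (intro DERIV_cmult DERIV_divide) auto
        also have "(w x * g1 x - s x * u1 x) * u2 x - u1 x * (w x * g2 x - s x * u2 x) = - (w x * W)"
          unfolding Wx[symmetric] by (simp add: algebra_simps)
        also have "- (T * W) * (- (w x * W) / (u2 x)\<^sup>2) = T * w x * (W / u2 x)\<^sup>2"
          by (simp add: power2_eq_square)
        finally show "(h has_real_derivative (T * w x * (W / u2 x)\<^sup>2)) (at x)" .
      qed
    qed
    moreover have "AE x\<in>{c<..<d} in lebesgue. T * w x * (W / u2 x)\<^sup>2 > 0"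
      using T[OF that(1,2)]
    proof eventually_elim
      case (elim x)
      show ?case
      proof
        assume x: "x \<in> {c<..<d}"
        then have "x \<in> J" using subJ by auto
        then show "T * w x * (W / u2 x)\<^sup>2 > 0"
          using elim x nz \<open>W \<noteq> 0\<close> by (intro mult_pos_pos[of "T * w x"]) auto
      qed
    qed
    ultimately have "h c < h d" by (rule AC_on_strict_increase[OF _ that(3)])
    then show ?thesis by (simp add: h_def)
  qed
  then show ?thesis by (intro exI strict_mono_onI)
qed

section \<open>Separation of zeros, inside the interval and at its end points\<close>

text \<open>The multiplier \<open>T\<close>, 1 or -1, lets both signs of \<open>p\<close> be handled
  by a single argument.\<close>

lemma sign_definite_on_inverse:
  assumes "sign_definite_on J p"
  shows "\<exists>T. AE x\<in>J in lebesgue. T * (1 / p x) > 0"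
proof (cases "AE x\<in>J in lebesgue. p x > 0")
  case True
  then show ?thesis by (intro exI[of _ 1]) simp
next
  case False
  then have "AE x\<in>J in lebesgue. p x < 0" using assms by (simp add: sign_definite_on_def)
  then show ?thesis by (intro exI[of _ "-1"]) (simp add: divide_less_0_iff)
qed

text \<open>Used at an end point with \<open>x\<close> and \<open>y\<close> the values of
  \<open>u1\<close> and \<open>u2\<close>: once the quotient stays away from 0, \<open>u2\<close> is
  dominated by \<open>u1\<close> and inherits its limit 0.\<close>

lemma abs_le_if_quotient_away_from_0:
  fixes x y :: real
  assumes "\<kappa> > 0" "y \<noteq> 0" "\<kappa> \<le> \<bar>\<rho> * (x / y)\<bar>"
  shows "\<bar>y\<bar> \<le> \<bar>x\<bar> * (\<bar>\<rho>\<bar> / \<kappa>)"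
proof -
  have "\<kappa> * \<bar>y\<bar> \<le> \<bar>\<rho>\<bar> * \<bar>x\<bar>"
    using assms(2,3) by (simp add: abs_mult pos_le_divide_eq)
  then show ?thesis using assms(1) by (simp add: field_simps)
qed

theorem theorem11p1:
  fixes a b :: ereal
    and p q r s :: "real \<Rightarrow> real"
    and lam :: real
    and u1 u2 :: "real \<Rightarrow> real"
  assumes "a < b"
    and "p \<in> borel_measurable (lebesgue_on (einterval a b))"
    and "q \<in> borel_measurable (lebesgue_on (einterval a b))"
    and "r \<in> borel_measurable (lebesgue_on (einterval a b))"
    and "s \<in> borel_measurable (lebesgue_on (einterval a b))"
    and "locally_integrable (einterval a b) (\<lambda>x. 1 / p x)"
    and "locally_integrable (einterval a b) q"
    and "locally_integrable (einterval a b) r"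
    and "locally_integrable (einterval a b) s"
    and "AE x\<in>einterval a b in lebesgue. r x > 0"
    and "AE x\<in>einterval a b in lebesgue. p x \<noteq> 0"
    and "solution (einterval a b) p q r s lam u1"
    and "solution (einterval a b) p q r s lam u2"
    and "lin_indep_pair_on (einterval a b) u1 u2"
  shows "(\<forall>x1\<in>einterval a b. \<forall>x2\<in>einterval a b.
            x1 < x2 \<and> u1 x1 = 0 \<and> u1 x2 = 0 \<and> sign_definite_on {x1<..<x2} p
            \<longrightarrow> (\<exists>x\<in>{x1..x2}. u2 x = 0))
       \<and> (regular_left a b p q r s \<longrightarrow>
            (\<forall>x2\<in>einterval a b.
              zero_at_left_end a u1 \<and> u1 x2 = 0 \<and> sign_definite_on (einterval a (ereal x2)) p
              \<longrightarrow> zero_at_left_end a u2 \<or> (\<exists>x\<in>einterval a b. x \<le> x2 \<and> u2 x = 0)))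
       \<and> (regular_right a b p q r s \<longrightarrow>
            (\<forall>x1\<in>einterval a b.
              u1 x1 = 0 \<and> zero_at_right_end b u1 \<and> sign_definite_on (einterval (ereal x1) b) p
              \<longrightarrow> zero_at_right_end b u2 \<or> (\<exists>x\<in>einterval a b. x1 \<le> x \<and> u2 x = 0)))"
proof -
  define I where "I = einterval a b"
  have mem: "x \<in> I \<longleftrightarrow> a < ereal x \<and> ereal x < b" for x
    by (simp add: I_def einterval_iff)
  have up: "a < ereal y" if "a < ereal x" "x \<le> y" for x y
    by (rule less_le_trans[OF that(1)]) (simp add: that)
  have down: "ereal x < b" if "ereal y < b" "x \<le> y" for x y
    by (rule le_less_trans[OF _ that(1)]) (simp add: that)
  have I: "open I" "is_interval I"
  proof -
    show "is_interval I"
      unfolding is_interval_1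
    proof (intro ballI allI impI)
      fix c d x assume "c \<in> I" "d \<in> I" "c \<le> x \<and> x \<le> d"
      then show "x \<in> I" using up[of c x] down[of d x] by (simp add: mem)
    qed
  qed (simp add: I_def)
  have loc: "locally_integrable I (\<lambda>x. q x - lam * r x)"
    unfolding locally_integrable_def
  proof (intro allI impI)
    fix K assume "compact K \<and> K \<subseteq> I"
    then have "set_integrable lebesgue K q" "set_integrable lebesgue K r"
      using assms(7,8) by (auto simp: locally_integrable_def I_def)
    then show "set_integrable lebesgue K (\<lambda>x. q x - lam * r x)"
      by (intro set_integral_diff(1) set_integrable_mult_right)
  qed
  have loc': "locally_integrable I (\<lambda>x. 1 / p x)" "locally_integrable I s"
    and indep: "lin_indep_pair_on I u1 u2"
    using assms(6,9,14) by (simp_all add: I_def)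
  obtain g1 where sys1: "sl_system I (\<lambda>x. 1 / p x) s (\<lambda>x. q x - lam * r x) u1 g1"
    using solution_imp_sl_system[OF assms(12,10,11)] unfolding I_def ..
  obtain g2 where sys2: "sl_system I (\<lambda>x. 1 / p x) s (\<lambda>x. q x - lam * r x) u2 g2"
    using solution_imp_sl_system[OF assms(13,10,11)] unfolding I_def ..
  \<comment> \<open>\<open>J\<close> contains the zero of \<open>u1\<close>, whereas the sign of
    \<open>p\<close> is known only on \<open>S\<close>; it suffices that \<open>S\<close> contains
    the open intervals between points of \<open>J\<close>.\<close>
  have mono: "\<exists>\<rho>. strict_mono_on J (\<lambda>x. \<rho> * (u1 x / u2 x))"
    if J: "is_interval J" "J \<subseteq> I" "z \<in> J" "u1 z = 0" "\<And>x. x \<in> J \<Longrightarrow> u2 x \<noteq> 0"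
      and sd: "sign_definite_on S p" and S: "\<And>c d. c \<in> J \<Longrightarrow> d \<in> J \<Longrightarrow> {c<..<d} \<subseteq> S" for J S z
  proof -
    obtain T where T: "AE x\<in>S in lebesgue. T * (1 / p x) > 0"
      using sign_definite_on_inverse[OF sd] ..
    have pos: "AE x\<in>{c<..<d} in lebesgue. T * (1 / p x) > 0" if "c \<in> J" "d \<in> J" for c d
      using T by eventually_elim (use S[OF that] in auto)
    show ?thesis
      by (rule sl_quotient_strict_mono[OF sys1 sys2 I loc' loc indep J pos])
  qed
  have "\<exists>x\<in>{x1..x2}. u2 x = 0"
    if x: "x1 \<in> I" "x2 \<in> I" "x1 < x2" "u1 x1 = 0" "u1 x2 = 0" and sd: "sign_definite_on {x1<..<x2} p"
    for x1 x2
  proof (rule ccontr)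
    assume nz: "\<not> (\<exists>x\<in>{x1..x2}. u2 x = 0)"
    obtain \<rho> where "strict_mono_on {x1..x2} (\<lambda>x. \<rho> * (u1 x / u2 x))"
    proof (rule exE[OF mono[OF _ _ _ x(4) _ sd]])
      show "{x1..x2} \<subseteq> I" using I(2) x by (intro is_interval_Icc_subset)
    qed (use x nz in \<open>auto simp: is_interval_cc\<close>)
    \<comment> \<open>The scaled quotient vanishes at both \<open>x1\<close> and \<open>x2\<close>,
      although it is strictly increasing.\<close>
    from strict_mono_onD[OF this, of x1 x2] show False using x by simp
  qed
  moreover have "zero_at_left_end a u2"
    if x2: "x2 \<in> I" and u1: "zero_at_left_end a u1" "u1 x2 = 0"
      and sd: "sign_definite_on (einterval a (ereal x2)) p"
      and nz: "\<not> (\<exists>x\<in>I. x \<le> x2 \<and> u2 x = 0)" for x2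
  proof -
    define J where "J = {x \<in> I. x \<le> x2}"
    have "is_interval J" using I(2) unfolding J_def is_interval_1 by fastforce
    moreover have "{c<..<d} \<subseteq> einterval a (ereal x2)" if "c \<in> J" "d \<in> J" for c d
      using that up[of c] by (auto simp: J_def mem einterval_iff)
    ultimately obtain \<rho> where \<rho>: "strict_mono_on J (\<lambda>x. \<rho> * (u1 x / u2 x))"
      using mono[of J x2 "einterval a (ereal x2)"] x2 u1 sd nz unfolding J_def by blast
    obtain m where "m \<in> einterval a (ereal x2)"
      using einterval_nonempty x2 mem by blast
    then have m: "a < ereal m" "m < x2" by (auto simp: einterval_iff)
    have mJ: "m \<in> J" "x2 \<in> J" using m x2 down[of x2 m] by (auto simp: J_def mem)
    \<comment> \<open>The increasing scaled quotient is zero at \<open>x2\<close>, hence negative at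
      \<open>m < x2\<close> and still smaller to the left of \<open>m\<close>;
      \<open>\<kappa>\<close> is its distance from 0 at \<open>m\<close>.\<close>
    define \<kappa> where "\<kappa> = - (\<rho> * (u1 m / u2 m))"
    have "\<kappa> > 0" using strict_mono_onD[OF \<rho> mJ] m u1 by (simp add: \<kappa>_def)
    have dom: "\<bar>u2 x\<bar> \<le> \<bar>u1 x\<bar> * (\<bar>\<rho>\<bar> / \<kappa>)" if "x \<in> J \<inter> {..<m}" for x
    proof (rule abs_le_if_quotient_away_from_0[OF \<open>\<kappa> > 0\<close>])
      show "u2 x \<noteq> 0" using that nz by (auto simp: J_def)
      have "\<rho> * (u1 x / u2 x) < \<rho> * (u1 m / u2 m)"
        using strict_mono_onD[OF \<rho> _ mJ(1), of x] that by blast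
      then show "\<kappa> \<le> \<bar>\<rho> * (u1 x / u2 x)\<bar>" unfolding \<kappa>_def by linarith
    qed
    have "\<forall>\<^sub>F y in at_right a. norm ((u2 \<circ> real_of_ereal) y) \<le> norm ((u1 \<circ> real_of_ereal) y) * (\<bar>\<rho>\<bar> / \<kappa>)"
      unfolding eventually_at_right[OF m(1)]
    proof (intro exI[of _ "ereal m"] conjI m allI impI)
      fix y assume y: "a < y" "y < ereal m"
      \<comment> \<open>A point strictly between \<open>a\<close> and \<open>ereal m\<close> is
        finite even when \<open>a\<close> is infinite, so the estimate on \<open>J\<close> applies
        to it.\<close>
      then obtain y' where y': "y = ereal y'" by (cases y) auto
      then have "y' \<in> J \<inter> {..<m}" using y m mJ down[of m y'] by (auto simp: J_def mem)
      then show "norm ((u2 \<circ> real_of_ereal) y) \<le> norm ((u1 \<circ> real_of_ereal) y) * (\<bar>\<rho>\<bar> / \<kappa>)"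
        using dom by (simp add: y')
    qed
    then show ?thesis
      using u1(1) unfolding zero_at_left_end_def by (rule tendsto_0_le[rotated])
  qed
  moreover have "zero_at_right_end b u2"
    if x1: "x1 \<in> I" and u1: "zero_at_right_end b u1" "u1 x1 = 0"
      and sd: "sign_definite_on (einterval (ereal x1) b) p"
      and nz: "\<not> (\<exists>x\<in>I. x1 \<le> x \<and> u2 x = 0)" for x1
  proof -
    define J where "J = {x \<in> I. x1 \<le> x}"
    have "is_interval J" using I(2) unfolding J_def is_interval_1 by fastforce
    moreover have "{c<..<d} \<subseteq> einterval (ereal x1) b" if "c \<in> J" "d \<in> J" for c d
      using that down[of d] by (auto simp: J_def mem einterval_iff)
    ultimately obtain \<rho> where \<rho>: "strict_mono_on J (\<lambda>x. \<rho> * (u1 x / u2 x))"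
      using mono[of J x1 "einterval (ereal x1) b"] x1 u1 sd nz unfolding J_def by blast
    obtain m where "m \<in> einterval (ereal x1) b"
      using einterval_nonempty x1 mem by blast
    then have m: "ereal m < b" "x1 < m" by (auto simp: einterval_iff)
    have mJ: "m \<in> J" "x1 \<in> J" using m x1 up[of x1 m] by (auto simp: J_def mem)
    \<comment> \<open>Here the zero \<open>x1\<close> lies to the left of \<open>m\<close>, so the
      scaled quotient is positive at \<open>m\<close> and larger beyond it; no change of sign
      occurs.\<close>
    define \<kappa> where "\<kappa> = \<rho> * (u1 m / u2 m)"
    have "\<kappa> > 0" using strict_mono_onD[OF \<rho> mJ(2,1)] m u1 by (simp add: \<kappa>_def)
    have dom: "\<bar>u2 x\<bar> \<le> \<bar>u1 x\<bar> * (\<bar>\<rho>\<bar> / \<kappa>)" if "x \<in> J \<inter> {m<..}" for x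
    proof (rule abs_le_if_quotient_away_from_0[OF \<open>\<kappa> > 0\<close>])
      show "u2 x \<noteq> 0" using that nz by (auto simp: J_def)
      have "\<rho> * (u1 m / u2 m) < \<rho> * (u1 x / u2 x)"
        using strict_mono_onD[OF \<rho> mJ(1), of x] that by blast
      then show "\<kappa> \<le> \<bar>\<rho> * (u1 x / u2 x)\<bar>" unfolding \<kappa>_def by linarith
    qed
    have "\<forall>\<^sub>F y in at_left b. norm ((u2 \<circ> real_of_ereal) y) \<le> norm ((u1 \<circ> real_of_ereal) y) * (\<bar>\<rho>\<bar> / \<kappa>)"
      unfolding eventually_at_left[OF m(1)]
    proof (intro exI[of _ "ereal m"] conjI m allI impI)
      fix y assume y: "ereal m < y" "y < b"
      then obtain y' where y': "y = ereal y'" by (cases y) auto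
      then have "y' \<in> J \<inter> {m<..}" using y m mJ up[of m y'] by (auto simp: J_def mem)
      then show "norm ((u2 \<circ> real_of_ereal) y) \<le> norm ((u1 \<circ> real_of_ereal) y) * (\<bar>\<rho>\<bar> / \<kappa>)"
        using dom by (simp add: y')
    qed
    then show ?thesis
      using u1(1) unfolding zero_at_right_end_def by (rule tendsto_0_le[rotated])
  qed
  ultimately show ?thesis unfolding I_def by blast
qed

end
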